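(* Let $m,n\ge 1$ be integers and, for $i=1,\dots,m$, let $Q_i\in\mathbb{R}^{n\times n}$ be symmetric positive semidefinite, $c_i\in\mathbb{R}^n$, $d_i\in\mathbb{R}$, and $g_i(x)=d_i-c_i^Tx-\frac12 x^TQ_ix$. Let $\mathcal{F}=\{x\in\mathbb{R}^n: g_i(x)\ge 0,\ i=1,\dots,m\}$. Suppose that the logarithmic barrier function $L(x)=-\sum_{i=1}^m\log(g_i(x))$, defined on $\{x\in\mathbb{R}^n: g_i(x)>0,\ i=1,\dots,m\}$, has a unique minimizer $\bar x$ (the analytic center of $\mathcal{F}$). Then $$\mathcal{F}\subseteq E\left(\bar x;\sqrt{m^2+m}\right),$$ where $E(\bar x;r)=\{x\in\mathbb{R}^n: (x-\bar x)^T\nabla^2L(\bar x)(x-\bar x)\le r^2\}$ for $r>0$.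
   Context: The set $\mathcal{F}$ is regarded as the intersection of $m$ ellipsoids (possibly degenerate, since each $Q_i$ is only required to be positive semidefinite). The logarithmic barrier function $L$ is defined where all $g_i(x)>0$, and its Hessian there is $$\nabla^2L(x)=\sum_{i=1}^m\left(\frac{(c_i+Q_ix)(c_i+Q_ix)^T}{g_i(x)^2}+\frac{Q_i}{g_i(x)}\right).$$ The analytic center $\bar x$ of $\mathcal{F}$ is the unique minimizer of $L$ over $\{x: g_i(x)>0,\ i=1,\dots,m\}$. The set $E(\bar x;r)$ is called the Dikin ellipsoid centered at $\bar x$ with radius $r$. *)

theory Defs
  imports "HOL-Analysis.Analysis"
begin

definition pos_semidef :: "real ^ 'n ^ 'n \<Rightarrow> bool" where
  "pos_semidef A \<longleftrightarrow> (\<forall>x. 0 \<le> x \<bullet> (A *v x))"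

definition partial_deriv :: "'n \<Rightarrow> (real ^ 'n \<Rightarrow> real) \<Rightarrow> real ^ 'n \<Rightarrow> real" where
  "partial_deriv i f x = deriv (\<lambda>t. f (x + t *\<^sub>R axis i 1)) 0"

text \<open>
  As \<^const>\<open>deriv\<close> is a total operator, this is the Hessian matrix only at points
  near which the partial derivatives involved exist.
\<close>

definition hessian :: "(real ^ 'n \<Rightarrow> real) \<Rightarrow> real ^ 'n \<Rightarrow> real ^ 'n ^ 'n" where
  "hessian f x = (\<chi> i j. partial_deriv i (partial_deriv j f) x)"

definition is_unique_minimizer :: "('a \<Rightarrow> real) \<Rightarrow> 'a set \<Rightarrow> 'a \<Rightarrow> bool" where
  "is_unique_minimizer f S x \<longleftrightarrow>
     is_arg_min f (\<lambda>y. y \<in> S) x \<and> (\<forall>y. is_arg_min f (\<lambda>y. y \<in> S) y \<longrightarrow> y = x)"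

definition quad_constr ::
    "real ^ 'n ^ 'n \<Rightarrow> real ^ 'n \<Rightarrow> real \<Rightarrow> real ^ 'n \<Rightarrow> real" where
  "quad_constr Q c d x = d - c \<bullet> x - 1 / 2 * (x \<bullet> (Q *v x))"

definition feasible_set :: "nat \<Rightarrow> (nat \<Rightarrow> real ^ 'n \<Rightarrow> real) \<Rightarrow> (real ^ 'n) set" where
  "feasible_set m g = {x. \<forall>i\<in>{1..m}. 0 \<le> g i x}"

definition strictly_feasible_set :: "nat \<Rightarrow> (nat \<Rightarrow> real ^ 'n \<Rightarrow> real) \<Rightarrow> (real ^ 'n) set" where
  "strictly_feasible_set m g = {x. \<forall>i\<in>{1..m}. 0 < g i x}"

text \<open>
  The barrier is meaningful only on \<^const>\<open>strictly_feasible_set\<close>. For continuous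
  constraint functions that set is open, so derivatives of the barrier at its points do
  not depend on the values of \<^const>\<open>ln\<close> at nonpositive arguments.
\<close>

definition log_barrier :: "nat \<Rightarrow> (nat \<Rightarrow> real ^ 'n \<Rightarrow> real) \<Rightarrow> real ^ 'n \<Rightarrow> real" where
  "log_barrier m g x = - (\<Sum>i\<in>{1..m}. ln (g i x))"

definition is_analytic_center ::
    "nat \<Rightarrow> (nat \<Rightarrow> real ^ 'n \<Rightarrow> real) \<Rightarrow> real ^ 'n \<Rightarrow> bool" where
  "is_analytic_center m g x \<longleftrightarrow>
     is_unique_minimizer (log_barrier m g) (strictly_feasible_set m g) x"

definition dikin_ellipsoid ::
    "(real ^ 'n \<Rightarrow> real) \<Rightarrow> real ^ 'n \<Rightarrow> real \<Rightarrow> (real ^ 'n) set" where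
  "dikin_ellipsoid L a r = {x. (x - a) \<bullet> (hessian L a *v (x - a)) \<le> r\<^sup>2}"

end

theory Submission
  imports Defs
begin

text \<open>
  Put \<open>h = x - xbar\<close>, \<open>s\<^sub>i = 1 - (c\<^sub>i + Q\<^sub>i xbar) \<bullet> h / g\<^sub>i(xbar)\<close> and
  \<open>q\<^sub>i = h \<bullet> Q\<^sub>i h / g\<^sub>i(xbar)\<close>. Feasibility of \<open>x\<close> says \<open>s\<^sub>i \<ge> q\<^sub>i / 2 \<ge> 0\<close>, and stationarity
  of the barrier at \<open>xbar\<close> says \<open>\<Sum> s\<^sub>i = m\<close>. The Hessian form at \<open>h\<close> is
  \<open>\<Sum> (1 - s\<^sub>i)\<^sup>2 + \<Sum> q\<^sub>i = \<Sum> s\<^sub>i\<^sup>2 - m + \<Sum> q\<^sub>i \<le> m\<^sup>2 - m + 2 m\<close>.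
\<close>

text \<open>Each nonnegative \<open>s i\<close> is at most the total, so its square is at most
  \<open>s i\<close> times the total. For infinite \<open>A\<close> both sums are 0 by
  convention.\<close>

lemma sum_squares_le_square_sum:
  fixes s :: "'a \<Rightarrow> 'b::linordered_idom"
  assumes "\<And>i. i \<in> A \<Longrightarrow> 0 \<le> s i"
  shows "(\<Sum>i\<in>A. (s i)\<^sup>2) \<le> (\<Sum>i\<in>A. s i)\<^sup>2"
proof (cases "finite A")
  case True
  have "(\<Sum>i\<in>A. (s i)\<^sup>2) \<le> (\<Sum>i\<in>A. s i * (\<Sum>j\<in>A. s j))"
    unfolding power2_eq_square using True assms
    by (intro sum_mono mult_left_mono member_le_sum) auto
  then show ?thesis
    by (simp add: power2_eq_square sum_distrib_right)
qed simp

text \<open>The second-order Taylor expansion is exact for a quadratic; symmetry of \<open>Q\<close>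
  merges the two mixed terms. It yields derivatives at \<open>t = 0\<close> and, at
  \<open>t = 1\<close>, the value at \<open>x + h\<close>.\<close>

lemma quad_constr_line:
  fixes Q :: "real ^ 'n ^ 'n"
  assumes "transpose Q = Q"
  shows "quad_constr Q c d (x + t *\<^sub>R h) =
    quad_constr Q c d x - t * ((c + Q *v x) \<bullet> h) - t\<^sup>2 / 2 * (h \<bullet> (Q *v h))"
proof -
  have "x \<bullet> (Q *v h) = h \<bullet> (Q *v x)"
    using assms by (metis dot_lmul_matrix inner_commute vector_transpose_matrix)
  then show ?thesis
    by (simp add: quad_constr_def matrix_vector_mult_add_rdistrib matrix_vector_right_distrib
        matrix_vector_mult_scaleR inner_simps inner_commute power2_eq_square algebra_simps)
qed

lemma quad_constr_line_deriv:
  fixes Q :: "real ^ 'n ^ 'n"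
  assumes "transpose Q = Q"
  shows "((\<lambda>t. quad_constr Q c d (x + t *\<^sub>R h)) has_real_derivative - ((c + Q *v x) \<bullet> h)) (at 0)"
  unfolding quad_constr_line[OF assms] by (auto intro!: derivative_eq_intros)

lemma continuous_quad_constr: "continuous_on UNIV (quad_constr Q c d)"
  unfolding quad_constr_def
  by (intro continuous_intros matrix_vector_mult_linear_continuous_on)

lemma quadratic_form_outer_product:
  fixes a h :: "real ^ 'n"
  shows "h \<bullet> ((\<chi> i j. a $ i * a $ j) *v h) = (a \<bullet> h)\<^sup>2"
proof -
  have "(\<chi> i j. a $ i * a $ j) *v h = (a \<bullet> h) *\<^sub>R a"
    by (simp add: vec_eq_iff matrix_vector_mult_def inner_vec_def sum_distrib_left
        sum_distrib_right ac_simps)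
  then show ?thesis
    by (simp add: inner_commute power2_eq_square)
qed

text \<open>For fixed \<open>h\<close> the form is linear in the matrix, so it can be evaluated on
  the Hessian summand by summand.\<close>

lemma linear_quadratic_form:
  fixes h :: "real ^ 'n"
  shows "linear (\<lambda>A. h \<bullet> (A *v h))"
  by (rule linearI)
    (simp_all add: matrix_vector_mult_add_rdistrib inner_add_right flip: scaleR_matrix_vector_assoc)

locale quadratic_constraints =
  fixes m :: nat
    and Q :: "nat \<Rightarrow> real ^ 'n ^ 'n"
    and c :: "nat \<Rightarrow> real ^ 'n"
    and d :: "nat \<Rightarrow> real"
    and g :: "nat \<Rightarrow> real ^ 'n \<Rightarrow> real"
  assumes sym: "i \<in> {1..m} \<Longrightarrow> transpose (Q i) = Q i"
    and g_eq: "i \<in> {1..m} \<Longrightarrow> g i = quad_constr (Q i) (c i) (d i)"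
begin

lemma open_strictly_feasible_set: "open (strictly_feasible_set m g)"
proof -
  have "strictly_feasible_set m g = (\<Inter>i\<in>{1..m}. {x. 0 < quad_constr (Q i) (c i) (d i) x})"
    by (auto simp: strictly_feasible_set_def g_eq)
  also have "open \<dots>"
    by (intro open_INT ballI open_Collect_less continuous_quad_constr continuous_intros) auto
  finally show ?thesis .
qed

text \<open>Second derivatives and the local minimum test both need strict feasibility near
  \<open>t = 0\<close>. The filter \<open>nhds 0\<close> includes \<open>t = 0\<close> itself, as
  replacing a function under \<open>deriv\<close> requires.\<close>

lemma eventually_strictly_feasible_line:
  assumes "x \<in> strictly_feasible_set m g"
  shows "\<forall>\<^sub>F t in nhds (0::real). x + t *\<^sub>R h \<in> strictly_feasible_set m g"
proof -
  have "isCont (\<lambda>t::real. x + t *\<^sub>R h) 0"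
    by (intro continuous_intros)
  then have "((\<lambda>t::real. x + t *\<^sub>R h) \<longlongrightarrow> x) (nhds 0)"
    using tendsto_at_iff_tendsto_nhds[of "\<lambda>t. x + t *\<^sub>R h" 0] by (simp add: continuous_at)
  then show ?thesis
    using topological_tendstoD open_strictly_feasible_set assms by blast
qed

text \<open>With \<open>h\<close> arbitrary, this covers both the partial derivatives
  (\<open>h\<close> a basis vector) and stationarity in the direction
  \<open>x - xbar\<close>.\<close>

lemma log_barrier_line_deriv:
  assumes "x \<in> strictly_feasible_set m g"
  shows "((\<lambda>t. log_barrier m g (x + t *\<^sub>R h)) has_real_derivative
    (\<Sum>i\<in>{1..m}. ((c i + Q i *v x) \<bullet> h) / g i x)) (at 0)"
proof -
  have "((\<lambda>t. ln (g i (x + t *\<^sub>R h))) has_real_derivative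
      - (((c i + Q i *v x) \<bullet> h) / g i x)) (at 0)" if "i \<in> {1..m}" for i
    using that assms
      DERIV_chain2[OF DERIV_ln_divide quad_constr_line_deriv[OF sym[OF that]]]
    by (simp add: strictly_feasible_set_def g_eq)
  from DERIV_minus[OF DERIV_sum[of "{1..m}", OF this]] show ?thesis
    by (simp add: log_barrier_def sum_negf)
qed

lemma partial_deriv_log_barrier:
  assumes "x \<in> strictly_feasible_set m g"
  shows "partial_deriv j (log_barrier m g) x = (\<Sum>i\<in>{1..m}. (c i + Q i *v x) $ j / g i x)"
  using DERIV_imp_deriv[OF log_barrier_line_deriv[OF assms, of "axis j 1"]]
  by (simp add: partial_deriv_def inner_axis)

lemma hessian_log_barrier:
  assumes "x \<in> strictly_feasible_set m g"
  shows "hessian (log_barrier m g) x =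
    (\<Sum>i\<in>{1..m}. (1 / (g i x)\<^sup>2) *\<^sub>R (\<chi> j k. (c i + Q i *v x) $ j * (c i + Q i *v x) $ k)
      + (1 / g i x) *\<^sub>R Q i)"
proof -
  let ?a = "\<lambda>i x. c i + Q i *v x"
  have "partial_deriv j (partial_deriv k (log_barrier m g)) x =
      (\<Sum>i\<in>{1..m}. ?a i x $ j * ?a i x $ k / (g i x)\<^sup>2 + Q i $ j $ k / g i x)" for j k
  proof -
    have "((\<lambda>t. ?a i (x + t *\<^sub>R axis j 1) $ k / g i (x + t *\<^sub>R axis j 1)) has_real_derivative
        ?a i x $ j * ?a i x $ k / (g i x)\<^sup>2 + Q i $ j $ k / g i x) (at 0)"
      if i: "i \<in> {1..m}" for i
    proof -
      \<comment> \<open>Differentiating the \<open>k\<close>-th component in direction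
        \<open>j\<close> produces entry \<open>(k, j)\<close>; symmetry turns it into the Hessian
        entry \<open>(j, k)\<close>.\<close>
      have "(Q i *v axis j 1) $ k = transpose (Q i) $ j $ k"
        by (simp add: matrix_vector_mult_basis column_def transpose_def)
      then have "(Q i *v axis j 1) $ k = Q i $ j $ k"
        by (simp add: sym[OF i])
      then have "((\<lambda>t. ?a i (x + t *\<^sub>R axis j 1) $ k) has_real_derivative Q i $ j $ k) (at 0)"
        by (auto intro!: derivative_eq_intros
            simp: matrix_vector_right_distrib matrix_vector_mult_scaleR)
      \<comment> \<open>This minus sign cancels the one in the quotient rule, so the rank-one term
        enters the Hessian with a plus.\<close>
      moreover have "((\<lambda>t. g i (x + t *\<^sub>R axis j 1)) has_real_derivative - (?a i x $ j)) (at 0)"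
        using quad_constr_line_deriv[OF sym[OF i], of "c i" "d i" x "axis j 1"] i
        by (simp add: g_eq inner_axis)
      moreover have "g i x > 0"
        using assms i by (auto simp: strictly_feasible_set_def)
      ultimately show ?thesis
        using DERIV_divide[of "\<lambda>t. ?a i (x + t *\<^sub>R axis j 1) $ k" "Q i $ j $ k" 0 UNIV
            "\<lambda>t. g i (x + t *\<^sub>R axis j 1)" "- (?a i x $ j)"]
        by (simp add: field_simps power2_eq_square del: vector_add_component)
    qed
    then have "((\<lambda>t. \<Sum>i\<in>{1..m}. ?a i (x + t *\<^sub>R axis j 1) $ k / g i (x + t *\<^sub>R axis j 1))
        has_real_derivative
        (\<Sum>i\<in>{1..m}. ?a i x $ j * ?a i x $ k / (g i x)\<^sup>2 + Q i $ j $ k / g i x)) (at 0)"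
      by (intro DERIV_sum) auto
    \<comment> \<open>The gradient formula is available only at strictly feasible points, but
      agreement near \<open>t = 0\<close> determines the derivative there.\<close>
    moreover have "\<forall>\<^sub>F t in nhds 0. partial_deriv k (log_barrier m g) (x + t *\<^sub>R axis j 1) =
        (\<Sum>i\<in>{1..m}. ?a i (x + t *\<^sub>R axis j 1) $ k / g i (x + t *\<^sub>R axis j 1))"
      using eventually_strictly_feasible_line[OF assms, of "axis j 1"]
      by eventually_elim (rule partial_deriv_log_barrier)
    ultimately show ?thesis
      unfolding partial_deriv_def[of j]
      by (simp add: DERIV_imp_deriv cong: deriv_cong_ev)
  qed
  then show ?thesis
    by (simp add: hessian_def vec_eq_iff)
qed

lemma hessian_log_barrier_form:
  assumes "x \<in> strictly_feasible_set m g"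
  shows "h \<bullet> (hessian (log_barrier m g) x *v h) =
    (\<Sum>i\<in>{1..m}. (((c i + Q i *v x) \<bullet> h) / g i x)\<^sup>2 + (h \<bullet> (Q i *v h)) / g i x)"
  unfolding hessian_log_barrier[OF assms] linear_sum[OF linear_quadratic_form]
    linear_add[OF linear_quadratic_form] linear_cmul[OF linear_quadratic_form]
    quadratic_form_outer_product
  by (simp add: power_divide)

text \<open>The minimizer lies in an open set, so along every line through it \<open>t = 0\<close>
  is a local minimum of the barrier and the directional derivative vanishes.\<close>

lemma analytic_center_stationary:
  assumes "is_analytic_center m g x"
  shows "(\<Sum>i\<in>{1..m}. ((c i + Q i *v x) \<bullet> h) / g i x) = 0"
proof -
  have x: "x \<in> strictly_feasible_set m g"
    and min: "\<And>y. y \<in> strictly_feasible_set m g \<Longrightarrow> log_barrier m g x \<le> log_barrier m g y"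
    using assms by (auto simp: is_analytic_center_def is_unique_minimizer_def is_arg_min_linorder)
  obtain e where "e > 0"
    and "\<And>t. dist t 0 < e \<Longrightarrow> x + t *\<^sub>R h \<in> strictly_feasible_set m g"
    using eventually_strictly_feasible_line[OF x] by (auto simp: eventually_nhds_metric)
  then show ?thesis
    using min DERIV_local_min[OF log_barrier_line_deriv[OF x], of e h] by (simp add: dist_real_def)
qed

end

theorem theorem1:
  fixes m :: nat
    and Q :: "nat \<Rightarrow> real ^ 'n ^ 'n"
    and c :: "nat \<Rightarrow> real ^ 'n"
    and d :: "nat \<Rightarrow> real"
    and g :: "nat \<Rightarrow> real ^ 'n \<Rightarrow> real"
    and xbar :: "real ^ 'n"
  assumes "m \<ge> 1"
    and "\<And>i. i \<in> {1..m} \<Longrightarrow> transpose (Q i) = Q i"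
    and "\<And>i. i \<in> {1..m} \<Longrightarrow> pos_semidef (Q i)"
    and "\<And>i. i \<in> {1..m} \<Longrightarrow> g i = quad_constr (Q i) (c i) (d i)"
    and "is_analytic_center m g xbar"
  shows "feasible_set m g \<subseteq> dikin_ellipsoid (log_barrier m g) xbar (sqrt (real m ^ 2 + real m))"
proof
  interpret quadratic_constraints m Q c d g
    using assms(2,4) by unfold_locales
  fix x assume x: "x \<in> feasible_set m g"
  define h where "h = x - xbar"
  define s where "s i = 1 - ((c i + Q i *v xbar) \<bullet> h) / g i xbar" for i
  define q where "q i = (h \<bullet> (Q i *v h)) / g i xbar" for i
  have xbar: "xbar \<in> strictly_feasible_set m g"
    using assms(5) by (simp add: is_analytic_center_def is_unique_minimizer_def is_arg_min_linorder)
  have q_nonneg: "0 \<le> q i" and q_le: "q i \<le> 2 * s i" if i: "i \<in> {1..m}" for i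
  proof -
    have pos: "0 < g i xbar"
      using xbar i by (auto simp: strictly_feasible_set_def)
    then show "0 \<le> q i"
      using assms(3)[OF i] by (simp add: q_def pos_semidef_def)
    have "0 \<le> g i (xbar + 1 *\<^sub>R h)"
      using x i by (simp add: h_def feasible_set_def)
    \<comment> \<open>The expansion at \<open>t = 1\<close> with the positive factor
      \<open>g i xbar\<close> taken out; feasibility of \<open>x\<close> then bounds
      \<open>q i\<close>.\<close>
    also have "\<dots> = g i xbar * (s i - q i / 2)"
      using pos unfolding g_eq[OF i] quad_constr_line[OF sym[OF i]]
      by (simp add: s_def q_def g_eq[OF i] field_simps)
    finally show "q i \<le> 2 * s i"
      using pos by (simp add: zero_le_mult_iff)
  qed
  have sum_s: "(\<Sum>i\<in>{1..m}. s i) = m"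
    using analytic_center_stationary[OF assms(5), of h] by (simp add: s_def sum_subtractf)
  have "h \<bullet> (hessian (log_barrier m g) xbar *v h) = (\<Sum>i\<in>{1..m}. (1 - s i)\<^sup>2 + q i)"
    by (simp add: hessian_log_barrier_form[OF xbar] s_def q_def)
  \<comment> \<open>Termwise, \<open>q i\<close> is absorbed by the cross term
    \<open>- 2 * s i\<close> of the expanded square.\<close>
  also have "\<dots> \<le> (\<Sum>i\<in>{1..m}. (s i)\<^sup>2 + 1)"
    using q_le by (intro sum_mono) (simp add: power2_diff)
  also have "\<dots> \<le> (\<Sum>i\<in>{1..m}. s i)\<^sup>2 + m"
  proof -
    \<comment> \<open>Semidefiniteness enters here through \<open>0 \<le> q i\<close>: together with
      \<open>q i \<le> 2 * s i\<close> it gives the sign that the bound on the sum of squares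
      requires.\<close>
    have "0 \<le> s i" if "i \<in> {1..m}" for i
      using q_nonneg[OF that] q_le[OF that] by linarith
    then show ?thesis
      using sum_squares_le_square_sum[of "{1..m}" s] by (simp add: sum.distrib)
  qed
  finally show "x \<in> dikin_ellipsoid (log_barrier m g) xbar (sqrt (real m ^ 2 + real m))"
    unfolding sum_s by (simp add: dikin_ellipsoid_def h_def)
qed

end
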